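(* Let $\mathcal{X}$ and $\mathcal{Y}$ be finite alphabets. For any joint distribution $P_{XY}$ on $\mathcal{X}\times\mathcal{Y}$, the opportunistic maximal leakage equals the maximal leakage: $\mathcal{L}(X\to Y)=\widetilde{\mathcal{L}}(X\to Y)$.
   Context: $\log$ is the natural logarithm. $U-X-Y$ denotes a Markov chain. The maximal leakage from $X$ to $Y$ is $$\mathcal{L}(X\to Y)=\sup_{U-X-Y-\hat U}\log\frac{\Pr(U=\hat U)}{\max_{u\in\mathcal{U}}P_U(u)},$$ the supremum being over all $U,\hat U$ taking values in the same finite, but arbitrary, alphabet $\mathcal{U}$. The opportunistic maximal leakage is $$\widetilde{\mathcal{L}}(X\to Y)=\log\sum_{y\in\mathcal{Y}}P_Y(y)\sup_{U:\,U-X-Y}\frac{\max_{u\in\mathcal{U}}P_{U|Y}(u|y)}{\max_{u\in\mathcal{U}}P_U(u)},$$ where, for each $y$, the supremum is over all $U$ with values in a finite but arbitrary alphabet (so $U$ may be chosen differently for each $y$); terms with $P_Y(y)=0$ contribute $0$. *)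

theory Defs
  imports "HOL-Probability.Probability"
begin

text \<open>
  \<open>A - B - C\<close> is a Markov chain: \<open>A\<close> and \<open>C\<close> are conditionally independent given \<open>B\<close>.
  All random variables are discrete and live on the sample space of the pmf \<open>q\<close>.
\<close>

definition markov_chain3 ::
  "'w pmf \<Rightarrow> ('w \<Rightarrow> 'a) \<Rightarrow> ('w \<Rightarrow> 'b) \<Rightarrow> ('w \<Rightarrow> 'c) \<Rightarrow> bool" where
  "markov_chain3 q A B C \<longleftrightarrow>
     (\<forall>a b c. measure_pmf.prob q {w. B w = b} > 0 \<longrightarrow>
        \<P>(w in measure_pmf q. A w = a \<and> C w = c \<bar> B w = b) =
        \<P>(w in measure_pmf q. A w = a \<bar> B w = b) * \<P>(w in measure_pmf q. C w = c \<bar> B w = b))"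

definition markov_chain4 ::
  "'w pmf \<Rightarrow> ('w \<Rightarrow> 'a) \<Rightarrow> ('w \<Rightarrow> 'b) \<Rightarrow> ('w \<Rightarrow> 'c) \<Rightarrow> ('w \<Rightarrow> 'd) \<Rightarrow> bool" where
  "markov_chain4 q A B C D \<longleftrightarrow>
     markov_chain3 q A B C \<and> markov_chain3 q (\<lambda>w. (A w, B w)) C D"

text \<open>
  Natural logarithm on the extended reals, with \<open>log 0 = -\<infinity>\<close> (the library \<open>ln\<close> has \<open>ln 0 = 0\<close>).
  Only nonnegative arguments matter.
\<close>

definition ereal_log :: "ereal \<Rightarrow> ereal" where
  "ereal_log r =
     (if r \<le> 0 then -\<infinity> else if r = \<infinity> then \<infinity> else ereal (ln (real_of_ereal r)))"

text \<open>
  Choosing random variables jointly distributed with \<open>(X, Y)\<close> means choosing a joint pmf whose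
  \<open>(X, Y)\<close>-marginal is the given one. An arbitrary finite alphabet is represented, up to
  relabelling its symbols, by an arbitrary finite set \<open>\<U>\<close> of natural numbers; \<open>\<U>\<close> may contain
  symbols of probability zero. Tuples are ordered \<open>(U, X, Y)\<close> and \<open>(U, X, Y, U')\<close>, where
  \<open>U'\<close> is the guess of \<open>U\<close>.
\<close>

definition attributes ::
  "('x \<times> 'y) pmf \<Rightarrow> (nat set \<times> (nat \<times> 'x \<times> 'y) pmf) set" where
  "attributes p = {(\<U>, q).
     finite \<U> \<and>
     set_pmf q \<subseteq> \<U> \<times> UNIV \<times> UNIV \<and>
     map_pmf (\<lambda>(u, x, y). (x, y)) q = p \<and>
     markov_chain3 q (\<lambda>(u, x, y). u) (\<lambda>(u, x, y). x) (\<lambda>(u, x, y). y)}"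

definition guessed_attributes ::
  "('x \<times> 'y) pmf \<Rightarrow> (nat set \<times> (nat \<times> 'x \<times> 'y \<times> nat) pmf) set" where
  "guessed_attributes p = {(\<U>, q).
     finite \<U> \<and>
     set_pmf q \<subseteq> \<U> \<times> UNIV \<times> UNIV \<times> \<U> \<and>
     map_pmf (\<lambda>(u, x, y, u'). (x, y)) q = p \<and>
     markov_chain4 q (\<lambda>(u, x, y, u'). u) (\<lambda>(u, x, y, u'). x)
       (\<lambda>(u, x, y, u'). y) (\<lambda>(u, x, y, u'). u')}"

definition maximal_leakage :: "('x \<times> 'y) pmf \<Rightarrow> ereal" where
  "maximal_leakage p =
     (SUP (\<U>, q) \<in> guessed_attributes p.
        ereal_log (ereal (
          measure_pmf.prob q {(u, x, y, u'). u = u'} /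
          (MAX u\<in>\<U>. measure_pmf.prob q {(v, x, y, v'). v = u}))))"

text \<open>
  The sum runs over the \<open>y\<close> of positive probability, so that the conditional probabilities given
  \<open>Y = y\<close> are well defined. The suprema are taken in the extended reals.
\<close>

definition opportunistic_maximal_leakage :: "('x \<times> 'y) pmf \<Rightarrow> ereal" where
  "opportunistic_maximal_leakage p =
     ereal_log (\<Sum>y\<in>set_pmf (map_pmf snd p).
       ereal (pmf (map_pmf snd p) y) *
       (SUP (\<U>, q) \<in> attributes p. ereal (
          (MAX u\<in>\<U>. \<P>((v, x, z) in measure_pmf q. v = u \<bar> z = y)) /
          (MAX u\<in>\<U>. measure_pmf.prob q {(v, x, z). v = u}))))"

end

theory Submission
  imports Defs
begin

text \<open>
  Both sides equal \<open>log (\<Sum>y. max\<^sub>x P(y|x))\<close>. For the upper bounds, \<open>U - X - Y\<close> gives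
  \<open>P(u, y) = (\<Sum>x. P(u, x) P(y|x)) \<le> P(u) max\<^sub>x P(y|x)\<close>.
  Both bounds are attained by one and the same \<open>U\<close>: with \<open>c\<close> the least positive probability of a
  symbol of \<open>X\<close>, split each symbol \<open>x\<close> into pieces of mass at most \<open>c\<close>, the first of which has mass
  exactly \<open>c\<close>, and let \<open>U\<close> be the piece. Then \<open>max\<^sub>u P(u) = c\<close>, and guessing, on seeing \<open>y\<close>, the first
  piece of a symbol \<open>x\<close> that maximises \<open>P(y|x)\<close> is correct with probability
  \<open>\<Sum>y. c max\<^sub>x P(y|x)\<close>.
\<close>

section \<open>Markov chains of discrete random variables\<close>

lemma prob_sum_finite:
  assumes "finite I" "\<And>w. w \<in> set_pmf q \<Longrightarrow> Q w \<Longrightarrow> X w \<in> I"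
  shows "measure_pmf.prob q {w. Q w} = (\<Sum>x\<in>I. measure_pmf.prob q {w. Q w \<and> X w = x})"
proof -
  have "measure_pmf.prob q {w. Q w} = measure_pmf.prob q (\<Union>x\<in>I. {w. Q w \<and> X w = x})"
    using assms(2) by (intro measure_eq_AE) (auto simp: AE_measure_pmf_iff)
  also have "\<dots> = (\<Sum>x\<in>I. measure_pmf.prob q {w. Q w \<and> X w = x})"
    using assms(1) by (intro measure_pmf.finite_measure_finite_Union) (auto simp: disjoint_family_on_def)
  finally show ?thesis .
qed

lemma prob_mono: "(\<And>w. Q w \<Longrightarrow> R w) \<Longrightarrow> measure_pmf.prob q {w. Q w} \<le> measure_pmf.prob q {w. R w}"
  by (intro measure_pmf.finite_measure_mono) auto

text \<open>Conditional independence with the denominators cleared. This form holds for every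
  \<open>b\<close>: if \<open>B = b\<close> has probability zero, both sides vanish.\<close>

lemma markov_chain3_joint:
  assumes "markov_chain3 q A B C"
  shows "measure_pmf.prob q {w. A w = a \<and> C w = c \<and> B w = b} * measure_pmf.prob q {w. B w = b} =
    measure_pmf.prob q {w. A w = a \<and> B w = b} * measure_pmf.prob q {w. C w = c \<and> B w = b}"
proof (cases "measure_pmf.prob q {w. B w = b} > 0")
  case True
  then show ?thesis
    using assms[unfolded markov_chain3_def, rule_format, OF True, of a c]
    by (simp add: cond_prob_def field_simps conj_assoc)
next
  case False
  then have "measure_pmf.prob q {w. B w = b} = 0"
    by (simp add: zero_less_measure_iff)
  moreover have "measure_pmf.prob q {w. A w = a \<and> B w = b} \<le> measure_pmf.prob q {w. B w = b}"
    by (rule prob_mono) simp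
  ultimately show ?thesis
    by (simp add: measure_le_0_iff)
qed

text \<open>Given \<open>B = b\<close>, the variable \<open>g (B w)\<close> is constant and hence
  independent of everything. A guess computed from Y therefore satisfies the second condition of the
  four-term chain.\<close>

lemma markov_chain3_comp:
  "markov_chain3 q A B (\<lambda>w. g (B w))"
  unfolding markov_chain3_def
proof (intro allI impI)
  fix a b c
  assume pos: "measure_pmf.prob q {w. B w = b} > 0"
  have *: "{w. A w = a \<and> g (B w) = c \<and> B w = b} = (if c = g b then {w. A w = a \<and> B w = b} else {})"
    "{w. g (B w) = c \<and> B w = b} = (if c = g b then {w. B w = b} else {})"
    by auto
  show "\<P>(w in q. A w = a \<and> g (B w) = c \<bar> B w = b) =
      \<P>(w in q. A w = a \<bar> B w = b) * \<P>(w in q. g (B w) = c \<bar> B w = b)"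
    using pos by (simp add: cond_prob_def conj_assoc *)
qed

text \<open>Summing the product form over all values of \<open>X\<close> marginalises it out.
  Applied to (U, X) - Y - U', this yields U - Y - U'.\<close>

lemma markov_chain3_drop_snd:
  fixes X :: "'w \<Rightarrow> 'x::finite"
  assumes "markov_chain3 q (\<lambda>w. (A w, X w)) B C"
  shows "markov_chain3 q A B C"
  unfolding markov_chain3_def
proof (intro allI impI)
  fix a b c
  assume pos: "measure_pmf.prob q {w. B w = b} > 0"
  have "measure_pmf.prob q {w. A w = a \<and> C w = c \<and> B w = b} * measure_pmf.prob q {w. B w = b} =
    (\<Sum>x\<in>UNIV. measure_pmf.prob q {w. (A w, X w) = (a, x) \<and> C w = c \<and> B w = b}
      * measure_pmf.prob q {w. B w = b})"
    by (subst prob_sum_finite[of UNIV _ _ X])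
      (auto simp: sum_distrib_right conj_ac intro!: sum.cong)
  also have "\<dots> = (\<Sum>x\<in>UNIV. measure_pmf.prob q {w. (A w, X w) = (a, x) \<and> B w = b}
      * measure_pmf.prob q {w. C w = c \<and> B w = b})"
    by (intro sum.cong refl markov_chain3_joint assms)
  also have "\<dots> = measure_pmf.prob q {w. A w = a \<and> B w = b} * measure_pmf.prob q {w. C w = c \<and> B w = b}"
    by (subst prob_sum_finite[of UNIV _ "\<lambda>w. A w = a \<and> B w = b" X])
      (auto simp: sum_distrib_right conj_ac intro!: sum.cong)
  finally show "\<P>(w in q. A w = a \<and> C w = c \<bar> B w = b) =
      \<P>(w in q. A w = a \<bar> B w = b) * \<P>(w in q. C w = c \<bar> B w = b)"
    using pos by (simp add: cond_prob_def field_simps conj_assoc)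
qed

section \<open>The upper bounds\<close>

text \<open>A symbol \<open>x\<close> of probability zero contributes the junk value \<open>0\<close>, which is harmless.\<close>

definition max_likelihood :: "('x::finite \<times> 'y) pmf \<Rightarrow> 'y \<Rightarrow> real" where
  "max_likelihood p y = (MAX x. pmf p (x, y) / pmf (map_pmf fst p) x)"

lemma likelihood_le: "pmf p (x, y) / pmf (map_pmf fst p) x \<le> max_likelihood p y"
  unfolding max_likelihood_def by (intro Max_ge) auto

lemma max_likelihood_attained:
  obtains x where "max_likelihood p y = pmf p (x, y) / pmf (map_pmf fst p) x"
proof -
  have "max_likelihood p y \<in> range (\<lambda>x. pmf p (x, y) / pmf (map_pmf fst p) x)"
    unfolding max_likelihood_def by (intro Max_in) auto
  then show ?thesis using that by auto
qed

lemma max_likelihood_nonneg: "0 \<le> max_likelihood p y"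
  by (rule order_trans[OF _ likelihood_le[of _ undefined]]) auto

lemma pmf_le_pmf_snd: "pmf p (x, y) \<le> pmf (map_pmf snd p) y"
  using measure_pmf.finite_measure_mono[of "{(x, y)}" "snd -` {y}" p]
  by (simp add: pmf_map measure_pmf_single)

text \<open>The joint mass p(x, y) is at most P(y) = 0, so every ratio vanishes. This reconciles a
  sum over the support of Y with a sum over all y.\<close>

lemma max_likelihood_eq_0:
  assumes "y \<notin> set_pmf (map_pmf snd p)"
  shows "max_likelihood p y = 0"
proof -
  have "pmf p (x, y) = 0" for x
    using pmf_le_pmf_snd[of p x y] assms pmf_nonneg[of p "(x, y)"]
    by (metis antisym pmf_eq_0_set_pmf)
  then show ?thesis by (metis max_likelihood_attained div_0)
qed

text \<open>By the Markov property P(u, y) is the sum over x of P(u, x) P(y|x). The sample space is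
  left abstract so that the bound serves both triples (U, X, Y) and quadruples (U, X, Y,
  U').\<close>

lemma prob_joint_le_max_likelihood:
  fixes X :: "'w \<Rightarrow> 'x::finite"
  assumes p: "map_pmf (\<lambda>w. (X w, Y w)) q = p" and markov: "markov_chain3 q U X Y"
  shows "measure_pmf.prob q {w. U w = u \<and> Y w = y} \<le>
    measure_pmf.prob q {w. U w = u} * max_likelihood p y"
proof -
  have fst: "pmf (map_pmf fst p) x = measure_pmf.prob q {w. X w = x}" for x
    unfolding p[symmetric] by (simp add: pmf.map_comp o_def pmf_map vimage_def)
  have pxy: "pmf p (x, y) = measure_pmf.prob q {w. Y w = y \<and> X w = x}" for x
    unfolding p[symmetric] by (simp add: pmf_map vimage_def conj_commute)
  have *: "measure_pmf.prob q {w. (U w = u \<and> Y w = y) \<and> X w = x} \<le>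
      measure_pmf.prob q {w. U w = u \<and> X w = x} * max_likelihood p y" for x
  \<comment> \<open>The likelihood of a null symbol x is a default value, so in that case the
    factorisation gives way to the fact that the left side is zero.\<close>
  proof (cases "measure_pmf.prob q {w. X w = x} = 0")
    case True
    then have "measure_pmf.prob q {w. (U w = u \<and> Y w = y) \<and> X w = x} \<le> 0"
      using prob_mono[of "\<lambda>w. (U w = u \<and> Y w = y) \<and> X w = x" "\<lambda>w. X w = x" q] by simp
    then show ?thesis
      by (rule order_trans) (simp add: max_likelihood_nonneg)
  next
    case False
    have "measure_pmf.prob q {w. (U w = u \<and> Y w = y) \<and> X w = x} =
        measure_pmf.prob q {w. U w = u \<and> X w = x} * (pmf p (x, y) / pmf (map_pmf fst p) x)"
      using False markov_chain3_joint[OF markov, of u y x] unfolding fst pxy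
      by (simp add: field_simps conj_assoc)
    also have "\<dots> \<le> measure_pmf.prob q {w. U w = u \<and> X w = x} * max_likelihood p y"
      by (intro mult_left_mono likelihood_le) simp
    finally show ?thesis .
  qed
  have "measure_pmf.prob q {w. U w = u \<and> Y w = y} =
      (\<Sum>x\<in>UNIV. measure_pmf.prob q {w. (U w = u \<and> Y w = y) \<and> X w = x})"
    by (rule prob_sum_finite) auto
  also have "\<dots> \<le> (\<Sum>x\<in>UNIV. measure_pmf.prob q {w. U w = u \<and> X w = x} * max_likelihood p y)"
    by (intro sum_mono *)
  also have "\<dots> = measure_pmf.prob q {w. U w = u} * max_likelihood p y"
    by (subst (2) prob_sum_finite[of UNIV _ _ X]) (auto simp: sum_distrib_right)
  finally show ?thesis .
qed

text \<open>The chain gives U - Y - U', so guessing u correctly together with y has probability P(u,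
  y) P(U' = u|y). The first factor is at most \<open>?m * max_likelihood p y\<close>, and the second
  sums over u to at most 1.\<close>

lemma prob_guess_le:
  fixes X :: "'w \<Rightarrow> 'x::finite" and Y :: "'w \<Rightarrow> 'y::finite"
  assumes fin: "finite \<U>" and U: "\<And>w. w \<in> set_pmf q \<Longrightarrow> U w \<in> \<U>"
    and p: "map_pmf (\<lambda>w. (X w, Y w)) q = p" and markov: "markov_chain4 q U X Y U'"
  shows "measure_pmf.prob q {w. U w = U' w} \<le>
    (MAX u\<in>\<U>. measure_pmf.prob q {w. U w = u}) * (\<Sum>y\<in>UNIV. max_likelihood p y)"
    (is "_ \<le> ?m * _")
proof -
  have UXY: "markov_chain3 q U X Y" and UYU': "markov_chain3 q U Y U'"
    using markov markov_chain3_drop_snd by (auto simp: markov_chain4_def)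
  have ne: "\<U> \<noteq> {}" using U set_pmf_not_empty[of q] by auto
  then have m0: "0 \<le> ?m" using fin by (auto simp: Max_ge_iff)
  let ?P = "measure_pmf.prob q"
  have *: "?P {w. U w = u \<and> U' w = u \<and> Y w = y} \<le>
      ?m * max_likelihood p y * (?P {w. U' w = u \<and> Y w = y} / ?P {w. Y w = y})"
    if u: "u \<in> \<U>" for u y
  proof (cases "?P {w. Y w = y} = 0")
    case True
    then show ?thesis
      using prob_mono[of "\<lambda>w. U w = u \<and> U' w = u \<and> Y w = y" "\<lambda>w. Y w = y" q] by simp
  next
    case False
    have "?P {w. U w = u \<and> Y w = y} \<le> ?P {w. U w = u} * max_likelihood p y"
      by (rule prob_joint_le_max_likelihood[OF p UXY])
    also have "\<dots> \<le> ?m * max_likelihood p y"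
      using fin u by (intro mult_right_mono max_likelihood_nonneg Max_ge) auto
    finally have le: "?P {w. U w = u \<and> Y w = y} \<le> ?m * max_likelihood p y" .
    have "?P {w. U w = u \<and> U' w = u \<and> Y w = y} =
        ?P {w. U w = u \<and> Y w = y} * (?P {w. U' w = u \<and> Y w = y} / ?P {w. Y w = y})"
      using markov_chain3_joint[OF UYU', of u u y] False by (simp add: field_simps)
    also have "\<dots> \<le>
        ?m * max_likelihood p y * (?P {w. U' w = u \<and> Y w = y} / ?P {w. Y w = y})"
      by (intro mult_right_mono le) auto
    finally show ?thesis .
  qed
  have sum_le: "(\<Sum>u\<in>\<U>. ?P {w. U' w = u \<and> Y w = y}) \<le> ?P {w. Y w = y}" for y
  proof -
    have "(\<Sum>u\<in>\<U>. ?P {w. U' w = u \<and> Y w = y}) = ?P (\<Union>u\<in>\<U>. {w. U' w = u \<and> Y w = y})"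
      using fin by (intro measure_pmf.finite_measure_finite_Union[symmetric])
        (auto simp: disjoint_family_on_def)
    also have "\<dots> \<le> ?P {w. Y w = y}"
      by (intro measure_pmf.finite_measure_mono) auto
    finally show ?thesis .
  qed
  have "?P {w. U w = U' w} = (\<Sum>y\<in>UNIV. ?P {w. U w = U' w \<and> Y w = y})"
    by (rule prob_sum_finite) auto
  also have "\<dots> = (\<Sum>y\<in>UNIV. \<Sum>u\<in>\<U>. ?P {w. (U w = U' w \<and> Y w = y) \<and> U w = u})"
    by (intro sum.cong refl prob_sum_finite fin U)
  also have "\<dots> = (\<Sum>y\<in>UNIV. \<Sum>u\<in>\<U>. ?P {w. U w = u \<and> U' w = u \<and> Y w = y})"
    by (intro sum.cong refl arg_cong[where f = ?P]) auto
  also have "\<dots> \<le> (\<Sum>y\<in>UNIV. \<Sum>u\<in>\<U>.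
      ?m * max_likelihood p y * (?P {w. U' w = u \<and> Y w = y} / ?P {w. Y w = y}))"
    by (intro sum_mono *)
  also have "\<dots> = (\<Sum>y\<in>UNIV. ?m * max_likelihood p y *
      ((\<Sum>u\<in>\<U>. ?P {w. U' w = u \<and> Y w = y}) / ?P {w. Y w = y}))"
    by (simp only: sum_distrib_left sum_divide_distrib)
  also have "\<dots> \<le> (\<Sum>y\<in>UNIV. ?m * max_likelihood p y)"
    using m0 sum_le
    by (intro sum_mono mult_right_le_one_le mult_nonneg_nonneg max_likelihood_nonneg)
      (auto simp: divide_le_eq_1 sum_nonneg zero_less_measure_iff)
  finally show ?thesis by (simp add: sum_distrib_left)
qed

section \<open>Attaining the bounds by shattering\<close>

text \<open>One piece receives weight t, and the remainder 1 - t is spread evenly over N further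
  pieces.\<close>

lemma shattering_weights:
  fixes t :: real
  assumes "0 < t" "t \<le> 1"
  obtains K :: "nat pmf" where "finite (set_pmf K)" "pmf K 0 = t" "\<And>i. pmf K i \<le> t"
proof -
  \<comment> \<open>From N > 1/t follows (1 - t)/N \<le> t, the ceiling on the remaining
    pieces.\<close>
  obtain N :: nat where N: "1 / t < real N" using reals_Archimedean2 by blast
  have N0: "N > 0" using N assms by (cases N) (auto simp: divide_less_0_iff)
  define K where "K = bind_pmf (bernoulli_pmf t)
    (\<lambda>b. if b then return_pmf 0 else pmf_of_set {1..N})"
  have K: "pmf K i = t * indicator {0} i + (1 - t) * (indicator {1..N} i / real N)" for i
    unfolding K_def using assms N0
    by (subst pmf_bind) (auto simp: integral_measure_pmf[of UNIV] UNIV_bool indicator_def)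
  have "(1 - t) / real N \<le> t"
    using N N0 assms by (simp add: field_simps)
  then have "pmf K i \<le> t" for i
    using assms by (auto simp: K indicator_def)
  moreover have "finite (set_pmf K)" unfolding K_def using N0 by (auto split: if_splits)
  moreover have "pmf K 0 = t" by (simp add: K)
  ultimately show ?thesis using that by blast
qed

text \<open>Cutting x into pieces of relative weight at most c/P(x) bounds their absolute mass by
  \<open>c\<close>. Pieces of different symbols get different codes, so no value \<open>u\<close>
  collects mass from two symbols. The first piece of x serves as \<open>s x\<close>.\<close>

lemma shattering:
  fixes P :: "'x::finite pmf"
  obtains K :: "'x \<Rightarrow> nat pmf" and s :: "'x \<Rightarrow> nat" and c :: real
  where "0 < c" "\<And>x. finite (set_pmf (K x))"
    "\<And>u. (\<Sum>x\<in>UNIV. pmf P x * pmf (K x) u) \<le> c"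
    "\<And>x. x \<in> set_pmf P \<Longrightarrow> pmf P x * pmf (K x) (s x) = c"
proof -
  define c where "c = Min (pmf P ` set_pmf P)"
  have "c \<in> pmf P ` set_pmf P"
    unfolding c_def by (intro Min_in) (auto simp: set_pmf_not_empty)
  then have c0: "0 < c" by (auto simp: pmf_positive)
  have c_le: "c \<le> pmf P x" if "x \<in> set_pmf P" for x
    unfolding c_def using that by (intro Min_le) auto
  \<comment> \<open>This relative weight becomes the absolute mass \<open>c\<close> after scaling by
    P(x). For null symbols the value 1 keeps 0 < t x \<le> 1.\<close>
  define t where "t x = (if x \<in> set_pmf P then c / pmf P x else 1)" for x
  have t: "0 < t x" "t x \<le> 1" for x
    using c0 c_le[of x] by (auto simp: t_def pmf_positive)
  have "\<exists>K :: nat pmf. finite (set_pmf K) \<and> pmf K 0 = t x \<and> (\<forall>i. pmf K i \<le> t x)" for x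
    by (rule shattering_weights[OF t[of x]]) blast
  then obtain K :: "'x \<Rightarrow> nat pmf" where K: "\<And>x. finite (set_pmf (K x))"
    "\<And>x. pmf (K x) 0 = t x" "\<And>x i. pmf (K x) i \<le> t x"
    by metis
  \<comment> \<open>Tagging a piece with its symbol through the injective code \<open>to_nat\<close>
    makes the supports of \<open>L x\<close> disjoint for different x.\<close>
  define L where "L x = map_pmf (\<lambda>i. to_nat (x, i)) (K x)" for x
  have L_same: "pmf (L x) (to_nat (x, i)) = pmf (K x) i" for x i
    unfolding L_def by (rule pmf_map_inj') (auto simp: inj_on_def)
  have L_other: "pmf (L x) u = 0" if "\<forall>i :: nat. u \<noteq> to_nat (x, i)" for x u
    using that by (auto simp: L_def pmf_eq_0_set_pmf)
  have mass: "pmf P x * pmf (L x) u \<le> c" for x u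
  proof (cases "(\<exists>i :: nat. u = to_nat (x, i)) \<and> x \<in> set_pmf P")
    case True
    then obtain i :: nat where u: "u = to_nat (x, i)" and x: "x \<in> set_pmf P" by auto
    have "pmf P x * pmf (L x) u \<le> pmf P x * t x"
      unfolding u L_same by (intro mult_left_mono K) auto
    also have "\<dots> = c" using x by (simp add: t_def pmf_eq_0_set_pmf)
    finally show ?thesis .
  next
    case False
    then have "pmf P x = 0 \<or> pmf (L x) u = 0" using L_other by (auto simp: pmf_eq_0_set_pmf)
    then show ?thesis using c0 by auto
  qed
  show ?thesis
  proof (rule that[of c L "\<lambda>x. to_nat (x, 0::nat)"])
    show "(\<Sum>x\<in>UNIV. pmf P x * pmf (L x) u) \<le> c" for u
    proof (cases "\<exists>x i. u = to_nat (x :: 'x, i :: nat)")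
      case True
      then obtain x :: 'x and i :: nat where u: "u = to_nat (x, i)" by auto
      have "(\<Sum>x'\<in>UNIV. pmf P x' * pmf (L x') u) = (\<Sum>x'\<in>{x}. pmf P x' * pmf (L x') u)"
        by (rule sum.mono_neutral_right) (auto simp: u L_other)
      then show ?thesis using mass[of x u] by simp
    next
      case False
      then have "pmf (L x) u = 0" for x by (intro L_other) auto
      then show ?thesis using c0 by simp
    qed
    show "pmf P x * pmf (L x) (to_nat (x, 0::nat)) = c" if "x \<in> set_pmf P" for x
      using that by (simp add: L_same K t_def pmf_eq_0_set_pmf)
  qed (auto simp: c0 L_def K)
qed

section \<open>Joint laws in which U is drawn from X through a channel\<close>

definition channel_joint :: "('x \<times> 'y) pmf \<Rightarrow> ('x \<Rightarrow> nat pmf) \<Rightarrow> (nat \<times> 'x \<times> 'y) pmf" where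
  "channel_joint p K = bind_pmf p (\<lambda>(x, y). map_pmf (\<lambda>u. (u, x, y)) (K x))"

lemma map_channel_joint: "map_pmf snd (channel_joint p K) = p"
proof -
  have "map_pmf snd (channel_joint p K) = bind_pmf p return_pmf"
    unfolding channel_joint_def map_bind_pmf
    by (intro bind_pmf_cong refl) (auto simp: pmf.map_comp o_def)
  then show ?thesis by (simp add: bind_return_pmf')
qed

text \<open>The draw at (x', y') produces only triples ending in (x', y'), so the mixture over
  \<open>p\<close> collapses to one term.\<close>

lemma pmf_channel_joint:
  "pmf (channel_joint p K) (u, x, y) = pmf p (x, y) * pmf (K x) u"
proof -
  have *: "pmf (map_pmf (\<lambda>u. (u, x', y')) (K x')) (u, x, y) =
      indicator {(x, y)} (x', y') * pmf (K x) u" for x' y'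
  proof (cases "(x', y') = (x, y)")
    case True
    then show ?thesis
      using pmf_map_inj'[of "\<lambda>u. (u, x, y)" "K x" u] by (auto simp: inj_on_def)
  next
    case False
    then show ?thesis by (auto simp: pmf_eq_0_set_pmf)
  qed
  have "pmf (channel_joint p K) (u, x, y) =
      (\<integral>z. indicator {(x, y)} z * pmf (K x) u \<partial>measure_pmf p)"
    unfolding channel_joint_def pmf_bind by (intro Bochner_Integration.integral_cong) (auto simp: *)
  then show ?thesis by (simp add: measure_pmf_single)
qed

lemma prob_channel_joint:
  fixes p :: "('x::finite \<times> 'y::finite) pmf"
  shows "measure_pmf.prob (channel_joint p K) {(v, x', y'). v = u \<and> x' \<in> A \<and> y' \<in> B} =
    (\<Sum>x\<in>A. \<Sum>y\<in>B. pmf p (x, y) * pmf (K x) u)"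
proof -
  have "{(v, x', y'). v = u \<and> x' \<in> A \<and> y' \<in> B} = {u} \<times> A \<times> B" by auto
  then show ?thesis
    by (simp add: measure_measure_pmf_finite sum.cartesian_product' pmf_channel_joint)
qed

lemma pmf_fst_sum: "pmf (map_pmf fst p) x = (\<Sum>y\<in>UNIV. pmf p (x, y :: 'y::finite))"
proof -
  have "pmf (map_pmf fst p) x = measure_pmf.prob p ({x} \<times> UNIV)"
    by (auto simp: pmf_map intro!: arg_cong[where f = "measure_pmf.prob p"])
  also have "\<dots> = (\<Sum>y\<in>UNIV. pmf p (x, y))"
    by (simp add: measure_measure_pmf_finite sum.cartesian_product')
  finally show ?thesis .
qed

text \<open>U is drawn from \<open>K x\<close> without regard to y, so P(u, x, y) = P(x, y) K(u|x)
  and P(u, x) = P(x) K(u|x); dividing by P(x) gives the factorisation.\<close>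

lemma markov_channel_joint:
  fixes p :: "('x::finite \<times> 'y::finite) pmf"
  shows "markov_chain3 (channel_joint p K) (\<lambda>(u, x, y). u) (\<lambda>(u, x, y). x) (\<lambda>(u, x, y). y)"
  unfolding markov_chain3_def
proof (intro allI impI)
  fix u x y
  let ?P = "measure_pmf.prob (channel_joint p K)"
  assume pos: "?P {w. (case w of (u, x, y) \<Rightarrow> x) = x} > 0"
  have X: "?P {(u', x', y'). x' = x} = pmf (map_pmf fst p) x"
    by (subst map_channel_joint[of p K, symmetric])
      (auto simp: pmf.map_comp pmf_map intro!: arg_cong[where f = ?P])
  have XY: "?P {(u', x', y'). y' = y \<and> x' = x} = pmf p (x, y)"
    by (subst (2) map_channel_joint[of p K, symmetric])
      (auto simp: pmf_map intro!: arg_cong[where f = ?P])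
  have UX: "?P {(u', x', y'). u' = u \<and> x' = x} = pmf (map_pmf fst p) x * pmf (K x) u"
    using prob_channel_joint[of p K u "{x}" UNIV]
    by (simp add: pmf_fst_sum sum_distrib_right)
  have UXY: "?P {(u', x', y'). (u' = u \<and> y' = y) \<and> x' = x} = pmf p (x, y) * pmf (K x) u"
    using prob_channel_joint[of p K u "{x}" "{y}"]
    by (simp add: conj_ac)
  show "\<P>(w in channel_joint p K. (case w of (u, x, y) \<Rightarrow> u) = u \<and> (case w of (u, x, y) \<Rightarrow> y) = y
        \<bar> (case w of (u, x, y) \<Rightarrow> x) = x) =
      \<P>(w in channel_joint p K. (case w of (u, x, y) \<Rightarrow> u) = u \<bar> (case w of (u, x, y) \<Rightarrow> x) = x) *
      \<P>(w in channel_joint p K. (case w of (u, x, y) \<Rightarrow> y) = y \<bar> (case w of (u, x, y) \<Rightarrow> x) = x)"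
    using pos X XY UX UXY by (simp add: cond_prob_def case_prod_beta' field_simps)
qed

lemma channel_joint_in_attributes:
  fixes p :: "('x::finite \<times> 'y::finite) pmf"
  assumes "finite \<U>" "\<And>x. set_pmf (K x) \<subseteq> \<U>"
  shows "(\<U>, channel_joint p K) \<in> attributes p"
proof -
  have "(\<lambda>(u :: nat, x :: 'x, y :: 'y). (x, y)) = snd" by auto
  moreover have "set_pmf (channel_joint p K) \<subseteq> \<U> \<times> UNIV \<times> UNIV"
    using assms(2) by (fastforce simp: channel_joint_def)
  ultimately show ?thesis
    using assms(1) by (simp add: attributes_def markov_channel_joint map_channel_joint)
qed

lemma markov_chain3_map_pmf:
  "markov_chain3 (map_pmf f q) A B C \<longleftrightarrow> markov_chain3 q (\<lambda>w. A (f w)) (\<lambda>w. B (f w)) (\<lambda>w. C (f w))"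
  by (simp add: markov_chain3_def cond_prob_def vimage_def)

text \<open>The guess g(Y) is a function of Y, so (U, X) - Y - g(Y) is an instance of
  \<open>markov_chain3_comp\<close>, and U - X - Y is inherited.\<close>

lemma guess_in_guessed_attributes:
  assumes "(\<U>, q) \<in> attributes p" and "range g \<subseteq> \<U>"
  shows "(\<U>, map_pmf (\<lambda>(u, x, y). (u, x, y, g y)) q) \<in> guessed_attributes p"
  using assms markov_chain3_comp[of q "\<lambda>w. (fst w, fst (snd w))" "\<lambda>w. snd (snd w)" g]
  by (auto simp: attributes_def guessed_attributes_def markov_chain4_def markov_chain3_map_pmf
      pmf.map_comp o_def case_prod_beta')

section \<open>Both leakages in closed form\<close>

text \<open>The bound of \<open>prob_joint_le_max_likelihood\<close> is reversed here at u = g y,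
  with P(u) replaced by its maximum. A single law \<open>q\<close> does this for every y at once, so
  letting U depend on y gains nothing; and \<open>g\<close> doubles as the optimal guess.\<close>

lemma shattering_attribute:
  fixes p :: "('x::finite \<times> 'y::finite) pmf"
  obtains \<U> q g where "(\<U>, q) \<in> attributes p" "range g \<subseteq> \<U>"
    "0 < (MAX u\<in>\<U>. measure_pmf.prob q {(v, x, y). v = u})"
    "\<And>y. (MAX u\<in>\<U>. measure_pmf.prob q {(v, x, y). v = u}) * max_likelihood p y
      \<le> measure_pmf.prob q {(v, x, z). v = g y \<and> z = y}"
proof -
  obtain K :: "'x \<Rightarrow> nat pmf" and s c where c0: "0 < c" and fin: "\<And>x. finite (set_pmf (K x))"
    and le: "\<And>u. (\<Sum>x\<in>UNIV. pmf (map_pmf fst p) x * pmf (K x) u) \<le> c"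
    and eq: "\<And>x. x \<in> set_pmf (map_pmf fst p) \<Longrightarrow> pmf (map_pmf fst p) x * pmf (K x) (s x) = c"
    by (rule shattering[of "map_pmf fst p"], rule that)
  obtain X where X: "\<And>y. max_likelihood p y = pmf p (X y, y) / pmf (map_pmf fst p) (X y)"
    using max_likelihood_attained by metis
  \<comment> \<open>\<open>range s\<close> is included because \<open>shattering\<close> places
    \<open>s x\<close> in the support of \<open>K x\<close> only for x of positive probability,
    while every guess must lie in the alphabet.\<close>
  define \<U> where "\<U> = (\<Union>x. set_pmf (K x)) \<union> range s"
  let ?q = "channel_joint p K"
  let ?m = "MAX u\<in>\<U>. measure_pmf.prob ?q {(v, x, y). v = u}"
  have finU: "finite \<U>" using fin by (simp add: \<U>_def)
  have PU: "measure_pmf.prob ?q {(v, x, y). v = u} =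
      (\<Sum>x\<in>UNIV. pmf (map_pmf fst p) x * pmf (K x) u)" for u
    using prob_channel_joint[of p K u UNIV UNIV] by (simp add: pmf_fst_sum sum_distrib_right)
  have m_le: "?m \<le> c"
    using finU le by (subst Max_le_iff) (auto simp: PU \<U>_def)
  \<comment> \<open>For any symbol of positive probability, U equals its piece \<open>s x0\<close>
    with probability at least \<open>c\<close>, so the largest P(u) is positive.\<close>
  obtain x0 where x0: "x0 \<in> set_pmf (map_pmf fst p)" using set_pmf_not_empty[of "map_pmf fst p"] by blast
  have "c = pmf (map_pmf fst p) x0 * pmf (K x0) (s x0)" using eq x0 by simp
  also have "\<dots> \<le> measure_pmf.prob ?q {(v, x, y). v = s x0}"
    unfolding PU by (rule member_le_sum) auto
  also have "\<dots> \<le> ?m"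
    using finU by (intro Max_ge) (auto simp: \<U>_def)
  finally have m0: "0 < ?m" using c0 by simp
  have "?m * max_likelihood p y \<le> measure_pmf.prob ?q {(v, x, z). v = s (X y) \<and> z = y}" for y
  proof (cases "X y \<in> set_pmf (map_pmf fst p)")
    case True
    have "?m * max_likelihood p y \<le> c * max_likelihood p y"
      by (intro mult_right_mono m_le max_likelihood_nonneg)
    \<comment> \<open>With x = \<open>X y\<close>, c P(y|x) = P(x, y) c/P(x) = P(x, y) K(s x|x) by
      the choice of \<open>s\<close>.\<close>
    also have "\<dots> = pmf p (X y, y) * pmf (K (X y)) (s (X y))"
      using eq[OF True] True unfolding X by (auto simp: field_simps pmf_eq_0_set_pmf)
    also have "\<dots> \<le> (\<Sum>x\<in>UNIV. pmf p (x, y) * pmf (K x) (s (X y)))"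
      by (rule member_le_sum) auto
    also have "\<dots> = measure_pmf.prob ?q {(v, x, z). v = s (X y) \<and> z = y}"
      using prob_channel_joint[of p K "s (X y)" UNIV "{y}"] by simp
    finally show ?thesis .
  next
    case False
    \<comment> \<open>The maximiser is a null symbol, so its ratio is the default value of division
      by zero.\<close>
    then have "max_likelihood p y = 0" by (simp add: X pmf_eq_0_set_pmf del: set_map_pmf)
    then show ?thesis by simp
  qed
  moreover have "(\<U>, ?q) \<in> attributes p"
    using finU by (rule channel_joint_in_attributes) (auto simp: \<U>_def)
  moreover have "range (\<lambda>y. s (X y)) \<subseteq> \<U>"
    by (auto simp: \<U>_def)
  ultimately show ?thesis
    using that m0 by blast
qed

lemma ereal_log_mono: "a \<le> b \<Longrightarrow> ereal_log a \<le> ereal_log b"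
  by (cases a; cases b) (auto simp: ereal_log_def)

text \<open>For m = 0 the quotient is 0 by convention, which 0 \<le> b absorbs; the upper bounds can
  thus start from mere nonnegativity of the largest P(u).\<close>

lemma divide_le_of_le_mult:
  fixes a m b :: real
  assumes "a \<le> m * b" "0 \<le> m" "0 \<le> b"
  shows "a / m \<le> b"
  using assms by (cases "m = 0") (auto simp: field_simps)

text \<open>\<open>prob_guess_le\<close> bounds every ratio from above; the shattered U with the
  deterministic guess g(Y) attains the bound.\<close>

lemma maximal_leakage_eq:
  fixes p :: "('x::finite \<times> 'y::finite) pmf"
  shows "maximal_leakage p = ereal_log (ereal (\<Sum>y\<in>UNIV. max_likelihood p y))"
proof (rule antisym)
  show "maximal_leakage p \<le> ereal_log (ereal (\<Sum>y\<in>UNIV. max_likelihood p y))"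
    unfolding maximal_leakage_def
  proof (rule SUP_least, clarify)
    fix \<U> q assume "(\<U>, q) \<in> guessed_attributes p"
    then have fin: "finite \<U>" and sub: "set_pmf q \<subseteq> \<U> \<times> UNIV \<times> UNIV \<times> \<U>"
      and p: "map_pmf (\<lambda>(u, x, y, u'). (x, y)) q = p"
      and markov: "markov_chain4 q (\<lambda>(u, x, y, u'). u) (\<lambda>(u, x, y, u'). x)
       (\<lambda>(u, x, y, u'). y) (\<lambda>(u, x, y, u'). u')"
      by (auto simp: guessed_attributes_def)
    have "\<U> \<noteq> {}" using sub set_pmf_not_empty[of q] by auto
    then have m0: "0 \<le> (MAX u\<in>\<U>. measure_pmf.prob q {(v, x, y, v'). v = u})"
      using fin by (auto simp: Max_ge_iff)
    have "measure_pmf.prob q {(u, x, y, u'). u = u'} \<le>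
      (MAX u\<in>\<U>. measure_pmf.prob q {(v, x, y, v'). v = u}) * (\<Sum>y\<in>UNIV. max_likelihood p y)"
      using prob_guess_le[OF fin _ _ markov, of p] sub p by (force simp: case_prod_beta')
    then show "ereal_log (ereal (measure_pmf.prob q {(u, x, y, u'). u = u'} /
          (MAX u\<in>\<U>. measure_pmf.prob q {(v, x, y, v'). v = u})))
        \<le> ereal_log (ereal (\<Sum>y\<in>UNIV. max_likelihood p y))"
      using m0
      by (auto simp: max_likelihood_nonneg intro!: ereal_log_mono divide_le_of_le_mult sum_nonneg)
  qed
next
  obtain \<U> q g where q: "(\<U>, q) \<in> attributes p" and g: "range g \<subseteq> \<U>"
    and m0: "0 < (MAX u\<in>\<U>. measure_pmf.prob q {(v, x, y). v = u})"
    and ge: "\<And>y. (MAX u\<in>\<U>. measure_pmf.prob q {(v, x, y). v = u}) * max_likelihood p y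
      \<le> measure_pmf.prob q {(v, x, z). v = g y \<and> z = y}"
    by (rule shattering_attribute[of p], rule that)
  let ?m = "MAX u\<in>\<U>. measure_pmf.prob q {(v, x, y). v = u}"
  let ?r = "map_pmf (\<lambda>(u, x, y). (u, x, y, g y)) q"
  have m: "(MAX u\<in>\<U>. measure_pmf.prob ?r {(v, x, y, v'). v = u}) = ?m"
    by (simp add: vimage_def case_prod_beta')
  have "?m * (\<Sum>y\<in>UNIV. max_likelihood p y) \<le>
      (\<Sum>y\<in>UNIV. measure_pmf.prob q {(v, x, z). v = g y \<and> z = y})"
    unfolding sum_distrib_left by (intro sum_mono ge)
  also have "\<dots> = (\<Sum>y\<in>UNIV. measure_pmf.prob q {w. fst w = g (snd (snd w)) \<and> snd (snd w) = y})"
    by (intro sum.cong refl arg_cong[where f = "measure_pmf.prob q"]) auto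
  also have "\<dots> = measure_pmf.prob q {w. fst w = g (snd (snd w))}"
    by (rule prob_sum_finite[symmetric]) auto
  also have "\<dots> = measure_pmf.prob ?r {(u, x, y, u'). u = u'}"
    by (simp add: vimage_def case_prod_beta')
  finally have "(\<Sum>y\<in>UNIV. max_likelihood p y) \<le>
      measure_pmf.prob ?r {(u, x, y, u'). u = u'} /
      (MAX u\<in>\<U>. measure_pmf.prob ?r {(v, x, y, v'). v = u})"
    unfolding m using m0 by (simp add: field_simps)
  then show "ereal_log (ereal (\<Sum>y\<in>UNIV. max_likelihood p y)) \<le> maximal_leakage p"
    unfolding maximal_leakage_def
    by (intro SUP_upper2[OF guess_in_guessed_attributes[OF q g]]) (auto intro!: ereal_log_mono)
qed

text \<open>Dividing the joint bound by P(y) > 0 bounds every ratio in the supremum. The shattered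
  attribute attains it, with g y as the value of U whose posterior is large enough.\<close>

lemma pointwise_leakage_eq:
  fixes p :: "('x::finite \<times> 'y::finite) pmf"
  assumes y: "y \<in> set_pmf (map_pmf snd p)"
  shows "(SUP (\<U>, q) \<in> attributes p. ereal (
      (MAX u\<in>\<U>. \<P>((v, x, z) in measure_pmf q. v = u \<bar> z = y)) /
      (MAX u\<in>\<U>. measure_pmf.prob q {(v, x, z). v = u}))) =
    ereal (max_likelihood p y / pmf (map_pmf snd p) y)"
proof -
  have y0: "0 < pmf (map_pmf snd p) y" using y by (simp add: pmf_positive)
  \<comment> \<open>All attributes share the marginal \<open>p\<close>, so the conditioning event
    has the same probability P(y) under each of them.\<close>
  have cond: "\<P>((v, x, z) in measure_pmf q. v = u \<bar> z = y) =
      measure_pmf.prob q {(v, x, z). v = u \<and> z = y} / pmf (map_pmf snd p) y"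
    if q: "(\<U>, q) \<in> attributes p" for \<U> q u
  proof -
    have "pmf (map_pmf snd p) y = measure_pmf.prob q {w. snd (snd w) = y}"
      using q by (auto simp: attributes_def pmf.map_comp o_def pmf_map vimage_def case_prod_beta')
    then show ?thesis by (simp add: cond_prob_def case_prod_beta')
  qed
  show ?thesis
  proof (rule antisym)
    show "(SUP (\<U>, q) \<in> attributes p. ereal (
        (MAX u\<in>\<U>. \<P>((v, x, z) in measure_pmf q. v = u \<bar> z = y)) /
        (MAX u\<in>\<U>. measure_pmf.prob q {(v, x, z). v = u})))
      \<le> ereal (max_likelihood p y / pmf (map_pmf snd p) y)"
    proof (rule SUP_least, clarify)
      fix \<U> q assume q: "(\<U>, q) \<in> attributes p"
      then have fin: "finite \<U>" and sub: "set_pmf q \<subseteq> \<U> \<times> UNIV \<times> UNIV"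
        and p: "map_pmf (\<lambda>(u, x, y). (x, y)) q = p"
        and markov: "markov_chain3 q (\<lambda>(u, x, y). u) (\<lambda>(u, x, y). x) (\<lambda>(u, x, y). y)"
        by (auto simp: attributes_def)
      have ne: "\<U> \<noteq> {}" using sub set_pmf_not_empty[of q] by auto
      let ?m = "MAX u\<in>\<U>. measure_pmf.prob q {(v, x, z). v = u}"
      have m0: "0 \<le> ?m" using fin ne by (auto simp: Max_ge_iff)
      have "\<P>((v, x, z) in measure_pmf q. v = u \<bar> z = y)
          \<le> ?m * (max_likelihood p y / pmf (map_pmf snd p) y)" if "u \<in> \<U>" for u
      proof -
        have "measure_pmf.prob q {(v, x, z). v = u \<and> z = y} \<le>
            measure_pmf.prob q {(v, x, z). v = u} * max_likelihood p y"
          using prob_joint_le_max_likelihood[OF _ markov, of p u y] p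
          by (simp add: case_prod_beta')
        also have "\<dots> \<le> ?m * max_likelihood p y"
          using fin that by (intro mult_right_mono max_likelihood_nonneg Max_ge) auto
        finally show ?thesis using y0 by (simp add: cond[OF q] divide_right_mono)
      qed
      then have "(MAX u\<in>\<U>. \<P>((v, x, z) in measure_pmf q. v = u \<bar> z = y))
          \<le> ?m * (max_likelihood p y / pmf (map_pmf snd p) y)"
        using fin ne by (subst Max_le_iff) auto
      then show "ereal ((MAX u\<in>\<U>. \<P>((v, x, z) in measure_pmf q. v = u \<bar> z = y)) / ?m)
          \<le> ereal (max_likelihood p y / pmf (map_pmf snd p) y)"
        using m0 by (auto simp: max_likelihood_nonneg intro!: divide_le_of_le_mult)
    qed
  next
    obtain \<U> q g where q: "(\<U>, q) \<in> attributes p" and g: "range g \<subseteq> \<U>"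
      and m0: "0 < (MAX u\<in>\<U>. measure_pmf.prob q {(v, x, y). v = u})"
      and ge: "\<And>y. (MAX u\<in>\<U>. measure_pmf.prob q {(v, x, y). v = u}) * max_likelihood p y
        \<le> measure_pmf.prob q {(v, x, z). v = g y \<and> z = y}"
      by (rule shattering_attribute[of p], rule that)
    let ?m = "MAX u\<in>\<U>. measure_pmf.prob q {(v, x, z). v = u}"
    have fin: "finite \<U>" using q by (simp add: attributes_def)
    have "?m * (max_likelihood p y / pmf (map_pmf snd p) y) \<le>
        \<P>((v, x, z) in measure_pmf q. v = g y \<bar> z = y)"
      using ge[of y] y0 by (simp add: cond[OF q] divide_right_mono)
    also have "\<dots> \<le> (MAX u\<in>\<U>. \<P>((v, x, z) in measure_pmf q. v = u \<bar> z = y))"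
      using fin g by (intro Max_ge) auto
    finally have "max_likelihood p y / pmf (map_pmf snd p) y \<le>
        (MAX u\<in>\<U>. \<P>((v, x, z) in measure_pmf q. v = u \<bar> z = y)) / ?m"
      using m0 by (simp add: pos_le_divide_eq mult.commute)
    then show "ereal (max_likelihood p y / pmf (map_pmf snd p) y) \<le>
      (SUP (\<U>, q) \<in> attributes p. ereal (
        (MAX u\<in>\<U>. \<P>((v, x, z) in measure_pmf q. v = u \<bar> z = y)) /
        (MAX u\<in>\<U>. measure_pmf.prob q {(v, x, z). v = u})))"
      by (intro SUP_upper2[OF q]) simp
  qed
qed

text \<open>Weighting by P(y) cancels the denominator of the pointwise supremum, and
  \<open>max_likelihood_eq_0\<close> extends the sum from the support of Y to all y.\<close>

lemma opportunistic_maximal_leakage_eq: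
  fixes p :: "('x::finite \<times> 'y::finite) pmf"
  shows "opportunistic_maximal_leakage p = ereal_log (ereal (\<Sum>y\<in>UNIV. max_likelihood p y))"
proof -
  have "opportunistic_maximal_leakage p = ereal_log (\<Sum>y\<in>set_pmf (map_pmf snd p).
      ereal (pmf (map_pmf snd p) y) * ereal (max_likelihood p y / pmf (map_pmf snd p) y))"
    unfolding opportunistic_maximal_leakage_def
    by (intro arg_cong[where f = ereal_log] sum.cong refl) (simp only: pointwise_leakage_eq)
  also have "\<dots> = ereal_log (\<Sum>y\<in>set_pmf (map_pmf snd p). ereal (max_likelihood p y))"
    by (intro arg_cong[where f = ereal_log] sum.cong refl) (simp add: pmf_positive less_imp_neq[symmetric] del: set_map_pmf)
  also have "(\<Sum>y\<in>set_pmf (map_pmf snd p). ereal (max_likelihood p y)) =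
      (\<Sum>y\<in>UNIV. ereal (max_likelihood p y))"
    by (rule sum.mono_neutral_left) (auto simp: max_likelihood_eq_0 simp del: set_map_pmf)
  finally show ?thesis by simp
qed

theorem theorem2:
  fixes p :: "('x::finite \<times> 'y::finite) pmf"
  shows "maximal_leakage p = opportunistic_maximal_leakage p"
  by (simp add: maximal_leakage_eq opportunistic_maximal_leakage_eq)

end
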